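(* Let $n$ be a non-negative integer, let $\mathcal F\subseteq\{0,1\}^n$ be increasing, and let $\mathcal G\subseteq\{0,1\}^n$ be maximal intersecting. Then $$\mathrm{Cov}(\mathcal F,\mathcal G)\ \ge\ 4\sum_{\varnothing\neq S\subseteq[n]}\hat{\mathcal F}(S)^2\,\hat{\mathcal G}(S)^2 .$$
   Context: Points of $\{0,1\}^n$ are identified with subsets of $[n]=\{1,\dots,n\}$ via indicator vectors, so subsets of $\{0,1\}^n$ are families of subsets of $[n]$. A family is increasing if it is closed under taking supersets (equivalently, its indicator function is increasing for the coordinatewise order). A family $\mathcal A$ is intersecting if $A\cap A'\neq\varnothing$ for all $A,A'\in\mathcal A$; it is maximal intersecting if it is intersecting and not properly contained in any larger intersecting family of subsets of $[n]$. The cube carries the uniform probability measure, with expectation $\mathbb{E}$. $\mathrm{Cov}(\mathcal F,\mathcal G):=\mathbb{E}[\mathbb 1_{\mathcal F}\mathbb 1_{\mathcal G}]-\mathbb{E}[\mathbb 1_{\mathcal F}]\mathbb{E}[\mathbb 1_{\mathcal G}]$, and $\hat{\mathcal F}(S):=\mathbb{E}[\mathbb 1_{\mathcal F}\chi_S]$ with $\chi_S(x):=(-1)^{\sum_{i\in S}x_i}$; similarly for $\hat{\mathcal G}(S)$. *)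

theory Defs
  imports "HOL-Probability.Probability_Mass_Function"
begin

text \<open>
  A point of the cube \<open>{0,1}\<^sup>n\<close> is represented by the subset of \<open>{1..n}\<close> whose indicator
  vector it is, so the cube is \<open>Pow {1..n}\<close> and the \<open>i\<close>-th coordinate of \<open>x\<close> is \<open>indicator x i\<close>.
\<close>

abbreviation cube :: "nat \<Rightarrow> nat set set" where
  "cube n \<equiv> Pow {1..n}"

definition increasing_family :: "nat \<Rightarrow> nat set set \<Rightarrow> bool" where
  "increasing_family n F \<longleftrightarrow>
     F \<subseteq> cube n \<and> (\<forall>A\<in>F. \<forall>B\<in>cube n. A \<subseteq> B \<longrightarrow> B \<in> F)"

text \<open>
  The two members may coincide, so an intersecting family never contains the empty set; for
  \<open>n = 0\<close> the empty family is the only intersecting one.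
\<close>

definition intersecting_family :: "nat \<Rightarrow> nat set set \<Rightarrow> bool" where
  "intersecting_family n F \<longleftrightarrow>
     F \<subseteq> cube n \<and> (\<forall>A\<in>F. \<forall>B\<in>F. A \<inter> B \<noteq> {})"

definition maximal_intersecting :: "nat \<Rightarrow> nat set set \<Rightarrow> bool" where
  "maximal_intersecting n F \<longleftrightarrow>
     intersecting_family n F \<and> \<not> (\<exists>H. intersecting_family n H \<and> F \<subset> H)"

definition cube_expectation :: "nat \<Rightarrow> (nat set \<Rightarrow> real) \<Rightarrow> real" where
  "cube_expectation n f = measure_pmf.expectation (pmf_of_set (cube n)) f"

definition Cov :: "nat \<Rightarrow> nat set set \<Rightarrow> nat set set \<Rightarrow> real" where
  "Cov n F G =
     cube_expectation n (\<lambda>x. indicator F x * indicator G x)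
     - cube_expectation n (indicator F) * cube_expectation n (indicator G)"

definition character :: "nat set \<Rightarrow> nat set \<Rightarrow> real" where
  "character S x = (-1) ^ (\<Sum>i\<in>S. indicator x i)"

definition fourier_coeff :: "nat \<Rightarrow> nat set set \<Rightarrow> nat set \<Rightarrow> real" where
  "fourier_coeff n F S = cube_expectation n (\<lambda>x. indicator F x * character S x)"

end

theory Submission
  imports Defs
begin

text \<open>
  Write \<open>g = 2 \<cdot> 1\<^sub>G - 1\<close> and \<open>h(T) = \<Sum>\<^sub>y 1\<^sub>F(y) g(y \<triangle> T)\<close>. Maximality makes \<open>G\<close> increasing and
  makes it contain exactly one of \<open>A\<close> and its complement, so \<open>g\<close> is odd under complementation and
  \<open>h(T\<^sup>c) = - h(T)\<close>. Monotonicity of both families makes \<open>h\<close> decreasing, hence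
  \<open>\<bar>h(T)\<bar> \<le> h(\<emptyset>)\<close>; moreover \<open>\<bar>h(T)\<bar> \<le> 2\<^sup>n / 2\<close> since \<open>g\<close> is balanced. The covariance is
  \<open>h(\<emptyset>)\<close> up to scaling, while by Parseval the Fourier sum is the mean square of \<open>h\<close>.
\<close>

section \<open>Correlations of monotone functions under shifts by symmetric difference\<close>

lemma sum_Pow_sym_diff:
  assumes "T \<subseteq> U"
  shows "(\<Sum>x\<in>Pow U. \<phi> (sym_diff x T)) = (\<Sum>x\<in>Pow U. \<phi> x)"
  by (rule sum.reindex_bij_witness[where i = "\<lambda>x. sym_diff x T" and j = "\<lambda>x. sym_diff x T"])
    (use assms in \<open>auto intro: arg_cong[where f = \<phi>]\<close>)

text \<open>Pairing \<open>y\<close> with \<open>sym_diff y {i}\<close> reverses the sign of the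
  difference \<open>?d\<close> of the two shifts of \<open>g\<close>. Twice the gap between the sums
  is thus a sum of products of an \<open>i\<close>-increment of \<open>f\<close> and one of
  \<open>g\<close>. Since \<open>i\<close> is not in \<open>T\<close>, the shift by \<open>T\<close>
  keeps the direction of the flip at \<open>i\<close>, so both increments have the same
  sign.\<close>

lemma correlation_flip_le:
  fixes f g :: "'a set \<Rightarrow> real"
  assumes f: "mono_on (Pow U) f" and g: "mono_on (Pow U) g"
    and i: "i \<in> U" "i \<notin> T" and T: "T \<subseteq> U"
  shows "(\<Sum>y\<in>Pow U. f y * g (sym_diff y (insert i T))) \<le> (\<Sum>y\<in>Pow U. f y * g (sym_diff y T))"
proof -
  let ?d = "\<lambda>y. g (sym_diff y T) - g (sym_diff y (insert i T))"
  define D where "D = (\<Sum>y\<in>Pow U. f y * ?d y)"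
  have neg: "?d (sym_diff y {i}) = - ?d y" for y
  proof -
    have "sym_diff (sym_diff y {i}) T = sym_diff y (insert i T)"
      and "sym_diff (sym_diff y {i}) (insert i T) = sym_diff y T"
      using i by auto
    then show ?thesis by simp
  qed
  have "D = (\<Sum>y\<in>Pow U. f (sym_diff y {i}) * ?d (sym_diff y {i}))"
    unfolding D_def using i by (subst sum_Pow_sym_diff[where T = "{i}" and \<phi> = "\<lambda>y. f y * ?d y"]) auto
  also have "\<dots> = (\<Sum>y\<in>Pow U. - (f (sym_diff y {i}) * ?d y))"
    unfolding neg by (simp add: algebra_simps)
  finally have "2 * D = D + (\<Sum>y\<in>Pow U. - (f (sym_diff y {i}) * ?d y))"
    by simp
  also have "\<dots> = (\<Sum>y\<in>Pow U. (f y - f (sym_diff y {i})) * ?d y)"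
    unfolding D_def sum.distrib[symmetric] by (intro sum.cong refl) (simp add: left_diff_distrib)
  also have "\<dots> \<ge> 0"
  proof (rule sum_nonneg)
    fix y assume y: "y \<in> Pow U"
    show "0 \<le> (f y - f (sym_diff y {i})) * ?d y"
    proof (cases "i \<in> y")
      case True
      have "f (sym_diff y {i}) \<le> f y"
        by (rule mono_onD[OF f]) (use y True in auto)
      moreover have "g (sym_diff y (insert i T)) \<le> g (sym_diff y T)"
        by (rule mono_onD[OF g]) (use y True i T in auto)
      ultimately show ?thesis by simp
    next
      case False
      have "f y \<le> f (sym_diff y {i})"
        by (rule mono_onD[OF f]) (use y False i in auto)
      moreover have "g (sym_diff y T) \<le> g (sym_diff y (insert i T))"
        by (rule mono_onD[OF g]) (use y False i T in auto)
      ultimately show ?thesis by (simp add: mult_nonpos_nonpos)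
    qed
  qed
  finally have "0 \<le> D" by simp
  then show ?thesis
    unfolding D_def by (simp add: algebra_simps sum_subtractf)
qed

lemma correlation_shift_le:
  fixes f g :: "'a set \<Rightarrow> real"
  assumes "mono_on (Pow U) f" "mono_on (Pow U) g" "finite U" "T \<subseteq> U"
  shows "(\<Sum>y\<in>Pow U. f y * g (sym_diff y T)) \<le> (\<Sum>y\<in>Pow U. f y * g y)"
proof -
  have "finite T" using assms finite_subset by blast
  then show ?thesis using \<open>T \<subseteq> U\<close>
  proof (induction T)
    case (insert i T)
    then show ?case
      using correlation_flip_le[OF assms(1,2), of i T] by force
  qed simp
qed

section \<open>Characters: orthogonality, Parseval and convolution\<close>

lemma character_eq_prod:
  "finite S \<Longrightarrow> character S x = (\<Prod>i\<in>S. if i \<in> x then -1 else 1)"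
  unfolding character_def power_sum by (rule prod.cong) auto

lemma character_sym_diff:
  "finite S \<Longrightarrow> character S (sym_diff x y) = character S x * character S y"
  by (auto simp: character_eq_prod prod.distrib[symmetric] intro!: prod.cong)

text \<open>Both sides are the parity sign of \<open>card (S \<inter> x)\<close>. This symmetry
  turns sums over frequencies into sums over points and back.\<close>

lemma character_commute:
  assumes "finite S" "finite x"
  shows "character S x = character x S"
proof -
  have *: "character A B = (-1) ^ card (A \<inter> B)" if "finite A" for A B
    using that by (simp add: character_eq_prod prod.If_cases)
  show ?thesis using assms by (simp add: * Int_commute)
qed

text \<open>Flipping one element \<open>i\<close> of \<open>z\<close> in the summation variable
  changes the sign of each term, so the sum equals its own negative.\<close>

lemma sum_character_eq_0:
  assumes "finite U" "z \<subseteq> U" "z \<noteq> {}"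
  shows "(\<Sum>S\<in>Pow U. character S z) = 0"
proof -
  obtain i where i: "i \<in> z" using assms by auto
  have fin: "finite z" "\<And>S. S \<in> Pow U \<Longrightarrow> finite S"
    using assms finite_subset by auto
  have i1: "character z {i} = -1"
    using fin i by (subst character_commute) (auto simp: character_eq_prod)
  have "(\<Sum>S\<in>Pow U. character S z) = (\<Sum>S\<in>Pow U. character z S)"
    using fin by (intro sum.cong character_commute) auto
  also have "\<dots> = (\<Sum>S\<in>Pow U. character z (sym_diff S {i}))"
    using assms i by (subst sum_Pow_sym_diff[where \<phi> = "character z"]) auto
  also have "\<dots> = - (\<Sum>S\<in>Pow U. character z S)"
    using fin i1 by (simp add: character_sym_diff sum_negf)
  also have "(\<Sum>S\<in>Pow U. character z S) = (\<Sum>S\<in>Pow U. character S z)"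
    using fin by (intro sum.cong character_commute) auto
  finally show ?thesis by simp
qed

lemma sum_character_mult_character:
  assumes "finite U" "x \<subseteq> U" "y \<subseteq> U"
  shows "(\<Sum>S\<in>Pow U. character S x * character S y) = (if x = y then 2 ^ card U else 0)"
proof -
  have "(\<Sum>S\<in>Pow U. character S x * character S y) = (\<Sum>S\<in>Pow U. character S (sym_diff x y))"
    using assms by (intro sum.cong refl character_sym_diff[symmetric]) (auto intro: finite_subset)
  also have "\<dots> = (if x = y then 2 ^ card U else 0)"
  proof (cases "x = y")
    case True
    then show ?thesis using assms by (simp add: character_def card_Pow)
  next
    case False
    then show ?thesis using assms by (subst sum_character_eq_0) auto
  qed
  finally show ?thesis .
qed

lemma character_parseval:
  assumes "finite U"
  shows "(\<Sum>S\<in>Pow U. (\<Sum>x\<in>Pow U. h x * character S x)\<^sup>2) = 2 ^ card U * (\<Sum>x\<in>Pow U. (h x)\<^sup>2)"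
proof -
  have "(\<Sum>S\<in>Pow U. (\<Sum>x\<in>Pow U. h x * character S x)\<^sup>2)
      = (\<Sum>S\<in>Pow U. \<Sum>x\<in>Pow U. \<Sum>y\<in>Pow U. h x * h y * (character S x * character S y))"
    by (simp add: power2_eq_square sum_product mult_ac)
  also have "\<dots> = (\<Sum>x\<in>Pow U. \<Sum>S\<in>Pow U. \<Sum>y\<in>Pow U. h x * h y * (character S x * character S y))"
    by (rule sum.swap)
  also have "\<dots> = (\<Sum>x\<in>Pow U. \<Sum>y\<in>Pow U. \<Sum>S\<in>Pow U. h x * h y * (character S x * character S y))"
    by (intro sum.cong refl sum.swap)
  also have "\<dots> = (\<Sum>x\<in>Pow U. \<Sum>y\<in>Pow U. if x = y then h x * h y * 2 ^ card U else 0)"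
    using assms by (intro sum.cong refl) (simp add: sum_distrib_left[symmetric] sum_character_mult_character)
  also have "\<dots> = 2 ^ card U * (\<Sum>x\<in>Pow U. (h x)\<^sup>2)"
    using assms by (simp add: sum_distrib_left power2_eq_square mult_ac)
  finally show ?thesis .
qed

text \<open>Every element is its own inverse under \<open>sym_diff\<close>, so this correlation is a
  convolution. Splitting off \<open>character S y\<close>, whose square is 1, leaves a shifted sum
  over \<open>g\<close>.\<close>

lemma character_convolution:
  assumes "finite U" "S \<subseteq> U"
  shows "(\<Sum>x\<in>Pow U. (\<Sum>y\<in>Pow U. f y * g (sym_diff y x)) * character S x)
    = (\<Sum>x\<in>Pow U. f x * character S x) * (\<Sum>x\<in>Pow U. g x * character S x)"
proof -
  have fin: "finite S" using assms finite_subset by blast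
  have sq: "character S y * character S y = 1" for y
    using character_sym_diff[OF fin, of y y] by (simp add: character_def)
  have "(\<Sum>x\<in>Pow U. (\<Sum>y\<in>Pow U. f y * g (sym_diff y x)) * character S x)
      = (\<Sum>y\<in>Pow U. \<Sum>x\<in>Pow U. f y * g (sym_diff y x) * character S x)"
    unfolding sum_distrib_right by (rule sum.swap)
  also have "\<dots> = (\<Sum>y\<in>Pow U. \<Sum>x\<in>Pow U. f y * character S y * (g (sym_diff x y) * character S (sym_diff x y)))"
  proof (intro sum.cong refl)
    fix x y :: "nat set"
    have "sym_diff y x = sym_diff x y" by auto
    then show "f y * g (sym_diff y x) * character S x =
        f y * character S y * (g (sym_diff x y) * character S (sym_diff x y))"
      using sq[of y] by (simp add: character_sym_diff[OF fin] mult_ac)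
  qed
  also have "\<dots> = (\<Sum>y\<in>Pow U. f y * character S y * (\<Sum>x\<in>Pow U. g x * character S x))"
    by (intro sum.cong refl)
      (simp only: sum_distrib_left[symmetric] Pow_iff sum_Pow_sym_diff[where \<phi> = "\<lambda>x. g x * character S x"])
  finally show ?thesis by (simp add: sum_distrib_right)
qed

section \<open>Expectations on the cube and the structure of maximal intersecting families\<close>

lemma cube_expectation_eq: "cube_expectation n f = (\<Sum>x\<in>cube n. f x) / 2 ^ n"
  unfolding cube_expectation_def
  by (subst integral_pmf_of_set) (auto simp: card_Pow)

lemma increasing_family_mono_on:
  "increasing_family n F \<Longrightarrow> mono_on (cube n) (indicator F :: _ \<Rightarrow> real)"
  by (auto simp: mono_on_def increasing_family_def indicator_def)

text \<open>Otherwise adding \<open>A\<close> would give a larger intersecting family;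
  \<open>A \<noteq> {}\<close> covers the intersection of \<open>A\<close> with itself.\<close>

lemma maximal_intersecting_memI:
  assumes "maximal_intersecting n G" "A \<in> cube n" "A \<noteq> {}" "\<And>B. B \<in> G \<Longrightarrow> A \<inter> B \<noteq> {}"
  shows "A \<in> G"
proof (rule ccontr)
  assume "A \<notin> G"
  moreover have "intersecting_family n (insert A G)"
    using assms by (auto simp: maximal_intersecting_def intersecting_family_def Int_commute)
  ultimately show False
    using assms(1) by (auto simp: maximal_intersecting_def)
qed

lemma maximal_intersecting_increasing:
  assumes "maximal_intersecting n G"
  shows "increasing_family n G"
proof -
  have G: "G \<subseteq> cube n" "\<And>A B. A \<in> G \<Longrightarrow> B \<in> G \<Longrightarrow> A \<inter> B \<noteq> {}"
    using assms by (auto simp: maximal_intersecting_def intersecting_family_def)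
  have "B \<in> G" if "A \<in> G" "B \<in> cube n" "A \<subseteq> B" for A B
    by (rule maximal_intersecting_memI[OF assms]) (use that G in blast)+
  then show ?thesis using G by (auto simp: increasing_family_def)
qed

text \<open>For \<open>n = 0\<close> the empty set is its own complement and the statement fails.\<close>

lemma maximal_intersecting_compl_iff:
  assumes "maximal_intersecting n G" "n > 0" "A \<in> cube n"
  shows "{1..n} - A \<in> G \<longleftrightarrow> A \<notin> G"
proof
  assume "{1..n} - A \<in> G"
  moreover have "({1..n} - A) \<inter> A = {}" by blast
  ultimately show "A \<notin> G"
    using assms(1) unfolding maximal_intersecting_def intersecting_family_def by meson
next
  assume A: "A \<notin> G"
  have G: "G \<subseteq> cube n" "{} \<notin> G"
    using assms(1) unfolding maximal_intersecting_def intersecting_family_def by blast+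
  show "{1..n} - A \<in> G"
  \<comment> \<open>The empty set meets nothing, so its exclusion from \<open>G\<close> yields no
    information, and its complement, the full set, is treated directly. A nonempty \<open>A\<close>
    outside \<open>G\<close> misses some member \<open>B\<close>, and the complement of
    \<open>A\<close> is a superset of \<open>B\<close>.\<close>
  proof (cases "A = {}")
    case True
    have "{1..n} \<inter> B \<noteq> {}" if "B \<in> G" for B
    proof -
      have "B \<subseteq> {1..n}" "B \<noteq> {}" using G that by auto
      then show ?thesis by blast
    qed
    then show ?thesis
      using maximal_intersecting_memI[OF assms(1), of "{1..n}"] True assms(2) by simp
  next
    case False
    then obtain B where "B \<in> G" "A \<inter> B = {}"
      using maximal_intersecting_memI[OF assms(1,3)] A by blast
    moreover from this have "B \<subseteq> {1..n} - A" using G(1) by blast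
    ultimately show ?thesis
      using maximal_intersecting_increasing[OF assms(1)] by (simp add: increasing_family_def)
  qed
qed

theorem corollary1p2:
  fixes n :: nat and F G :: "nat set set"
  assumes "increasing_family n F"
    and "maximal_intersecting n G"
  shows "Cov n F G \<ge>
    4 * (\<Sum>S\<in>{S. S \<noteq> {} \<and> S \<subseteq> {1..n}}. (fourier_coeff n F S)\<^sup>2 * (fourier_coeff n G S)\<^sup>2)"
proof (cases "n = 0")
  case True
  \<comment> \<open>With \<open>n = 0\<close> both sides vanish: \<open>G\<close> is empty and no
    nonempty frequency exists.\<close>
  then have "F = {} \<or> F = {{}}" "G = {}"
    using assms by (auto simp: increasing_family_def maximal_intersecting_def intersecting_family_def)
  moreover have "{S. S \<noteq> {} \<and> S \<subseteq> {1..n}} = {}" using True by auto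
  ultimately show ?thesis by (simp only: Cov_def cube_expectation_eq) simp
next
  case False
  define U where "U = {1..n}"
  define f where "f = (indicator F :: nat set \<Rightarrow> real)"
  define g where "g = (\<lambda>x. 2 * indicator G x - 1 :: real)"
  define h where "h T = (\<Sum>y\<in>Pow U. f y * g (sym_diff y T))" for T
  define N where "N = (2 :: real) ^ n"
  have U: "finite U" "card U = n" by (auto simp: U_def)
  have N: "N > 0" "real (card (Pow U)) = N" using U by (auto simp: N_def card_Pow)
  have f_mono: "mono_on (Pow U) f"
    using increasing_family_mono_on[OF assms(1)] by (simp add: f_def U_def)
  have g_mono: "mono_on (Pow U) g"
    using increasing_family_mono_on[OF maximal_intersecting_increasing[OF assms(2)]]
    by (auto simp: g_def U_def mono_on_def)
  have g_odd: "g (sym_diff x U) = - g x" if "x \<subseteq> U" for x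
  proof -
    have "sym_diff x U = {1..n} - x" using that by (auto simp: U_def)
    then show ?thesis
      using maximal_intersecting_compl_iff[OF assms(2), of x] False that
      by (auto simp: g_def U_def indicator_def)
  qed
  have g_sum: "(\<Sum>x\<in>Pow U. g x) = 0"
    using sum_Pow_sym_diff[of U U g] g_odd by (simp add: sum_negf)
  have h_le: "h T \<le> h {}" if "T \<subseteq> U" for T
    using correlation_shift_le[OF f_mono g_mono U(1) that] by (simp add: h_def)
  have h_odd: "h (U - T) = - h T" if "T \<subseteq> U" for T
    unfolding h_def sum_negf[symmetric]
  proof (rule sum.cong)
    fix y assume "y \<in> Pow U"
    then have "sym_diff y (U - T) = sym_diff (sym_diff y T) U" "sym_diff y T \<subseteq> U"
      using that by auto
    then show "f y * g (sym_diff y (U - T)) = - (f y * g (sym_diff y T))"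
      using g_odd[of "sym_diff y T"] by simp
  qed simp
  \<comment> \<open>The lower bound on \<open>h T\<close> is the upper bound at the complementary
    shift.\<close>
  have h_abs: "\<bar>h T\<bar> \<le> h {}" if "T \<subseteq> U" for T
    using h_le[OF that] h_le[of "U - T"] h_odd[OF that] by auto
  have h_bound: "\<bar>h T\<bar> \<le> N / 2" if "T \<subseteq> U" for T
  proof -
    \<comment> \<open>Every shift of \<open>g\<close> sums to 0, so \<open>f\<close> may be centred
      at 1/2. This halves the trivial bound \<open>N\<close>, as the constant 4 requires.\<close>
    have "h T = (\<Sum>y\<in>Pow U. (f y - 1/2) * g (sym_diff y T))"
      using sum_Pow_sym_diff[OF that, of g] g_sum
      by (simp add: h_def left_diff_distrib sum_subtractf sum_divide_distrib[symmetric])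
    also have "\<bar>\<dots>\<bar> \<le> (\<Sum>y\<in>Pow U. 1/2)"
      by (rule order_trans[OF sum_abs sum_mono]) (auto simp: f_def g_def indicator_def)
    finally show ?thesis using N by simp
  qed
  have h_sq: "(h T)\<^sup>2 \<le> h {} * (N / 2)" if "T \<subseteq> U" for T
    using mult_mono[OF h_abs[OF that] h_bound[OF that]] h_abs[of "{}"]
    by (simp add: power2_eq_square abs_mult_self_eq)
  have G_sum: "(\<Sum>x\<in>Pow U. indicator G x) = N / 2"
    using g_sum N by (simp add: g_def sum_subtractf sum_distrib_left[symmetric])
  have cov: "Cov n F G = h {} / (2 * N)"
  proof -
    have "h {} = 2 * (\<Sum>x\<in>Pow U. indicator F x * indicator G x) - (\<Sum>x\<in>Pow U. indicator F x)"
      by (simp add: h_def f_def g_def right_diff_distrib sum_subtractf sum_distrib_left mult_ac)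
    moreover have "Cov n F G = (\<Sum>x\<in>Pow U. indicator F x * indicator G x) / N
        - (\<Sum>x\<in>Pow U. indicator F x) / N * ((\<Sum>x\<in>Pow U. indicator G x) / N)"
      by (simp add: Cov_def cube_expectation_eq U_def N_def)
    ultimately show ?thesis
      using N unfolding G_sum by (simp add: field_simps)
  qed
  \<comment> \<open>At nonempty \<open>S\<close> the constant -1 in \<open>g\<close> contributes
    nothing, so \<open>g\<close> has twice the coefficient of \<open>G\<close>, and squaring gives
    the 4. The sums in \<open>h\<close> are unnormalised: each of the two coefficients costs a
    factor \<open>N\<close>, hence \<open>N ^ 4\<close> after squaring.\<close>
  have coeff: "4 * ((fourier_coeff n F S)\<^sup>2 * (fourier_coeff n G S)\<^sup>2)
      = (\<Sum>x\<in>Pow U. h x * character S x)\<^sup>2 / N ^ 4" if "S \<subseteq> U" "S \<noteq> {}" for S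
  proof -
    have "(\<Sum>x\<in>Pow U. character S x) = (\<Sum>x\<in>Pow U. character x S)"
      using that U finite_subset by (intro sum.cong character_commute) auto
    also have "\<dots> = 0" by (rule sum_character_eq_0) (use that U in auto)
    finally have "(\<Sum>x\<in>Pow U. g x * character S x) = 2 * (\<Sum>x\<in>Pow U. indicator G x * character S x)"
      by (simp only: g_def left_diff_distrib sum_subtractf sum_distrib_left mult.assoc mult_1_left diff_zero)
    moreover have "(\<Sum>x\<in>Pow U. indicator H x * character S x) = N * fourier_coeff n H S" for H
      using N(1) by (simp only: fourier_coeff_def cube_expectation_eq flip: U_def N_def) simp
    ultimately have "(\<Sum>x\<in>Pow U. h x * character S x)
        = N * fourier_coeff n F S * (2 * (N * fourier_coeff n G S))"
      using character_convolution[OF U(1) that(1), of f g] by (simp only: h_def f_def)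
    also have "\<dots>\<^sup>2 = 4 * ((fourier_coeff n F S)\<^sup>2 * (fourier_coeff n G S)\<^sup>2) * N ^ 4"
      by algebra
    finally show ?thesis
      using N(1) by simp
  qed
  have "4 * (\<Sum>S\<in>{S. S \<noteq> {} \<and> S \<subseteq> {1..n}}. (fourier_coeff n F S)\<^sup>2 * (fourier_coeff n G S)\<^sup>2)
      = (\<Sum>S\<in>{S. S \<noteq> {} \<and> S \<subseteq> U}. (\<Sum>x\<in>Pow U. h x * character S x)\<^sup>2 / N ^ 4)"
    unfolding sum_distrib_left U_def[symmetric] by (intro sum.cong refl coeff) auto
  \<comment> \<open>Parseval needs all frequencies; the added term at the empty set is a square
    divided by a positive number.\<close>
  also have "\<dots> \<le> (\<Sum>S\<in>Pow U. (\<Sum>x\<in>Pow U. h x * character S x)\<^sup>2 / N ^ 4)"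
    using U N by (intro sum_mono2) auto
  also have "\<dots> = (\<Sum>x\<in>Pow U. (h x)\<^sup>2) / N ^ 3"
    using character_parseval[OF U(1), of h] N U
    by (simp add: sum_divide_distrib[symmetric] power_numeral_reduce flip: N_def)
  \<comment> \<open>Each of the \<open>N\<close> squares is at most the product of the two bounds on
    \<open>h\<close>, which leaves exactly the covariance.\<close>
  also have "\<dots> \<le> (\<Sum>x\<in>Pow U. h {} * (N / 2)) / N ^ 3"
    using N by (intro divide_right_mono sum_mono h_sq) auto
  also have "\<dots> = h {} / (2 * N)"
    using N by (simp add: power_numeral_reduce)
  finally show ?thesis using cov by simp
qed

end
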